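(* Let $S,P,Q$ be pairwise disjoint finite sets and let $\mathcal{K}_{SP},\mathcal{K}_{PQ}$ be generalized number lattices on $S\uplus P$ and $P\uplus Q$ respectively. Then: 1. $\mathcal{K}_{SP}\leftrightarrow \mathcal{K}_{PQ} = (\mathcal{K}_{SP}+ \mathcal{K}_{(-P)Q}) \times (S\cup Q) = (\mathcal{K}_{SP}\cap \mathcal{K}_{PQ})\circ (S\cup Q)$, and $\mathcal{K}_{SP} \rightleftharpoons \mathcal{K}_{PQ} = (\mathcal{K}_{SP}+ \mathcal{K}_{PQ}) \times (S\cup Q) = (\mathcal{K}_{SP}\cap \mathcal{K}_{(-P)Q})\circ (S\cup Q)$. 2. $\mathcal{K}_{SP}\leftrightarrow\mathcal{K}_{PQ}$ and $\mathcal{K}_{SP}\rightleftharpoons \mathcal{K}_{PQ}$ are generalized number lattices. 3. Any set of vectors obtained from finitely many generalized number lattices by finitely many applications of the operations $+,\cap,\leftrightarrow,\rightleftharpoons$ is a generalized number lattice.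
   Context: All vectors are over $\mathbb{Q}$. For a finite set $X$, a vector on $X$ is a function $X\to\mathbb{Q}$; $\mathcal{F}_X$ is the set of all vectors on $X$ and $0_X$ the zero vector. For disjoint $X,Y$, $(f_X,g_Y)$ is the vector on $X\uplus Y$ agreeing with $f_X$ on $X$ and $g_Y$ on $Y$; a set of vectors on $X\uplus Y$ is denoted $\mathcal{K}_{XY}$. A number lattice on $X$ is the set of all integer linear combinations of finitely many vectors on $X$; a generalized number lattice on $X$ is a set $L_X+\mathcal{V}_X=\{a+b: a\in L_X, b\in\mathcal V_X\}$ with $L_X$ a number lattice and $\mathcal{V}_X$ a vector subspace of $\mathcal{F}_X$. For $\mathcal{K}_{XY}$, $\mathcal{K}_{(-X)Y}=\{(-f_X,g_Y):(f_X,g_Y)\in\mathcal{K}_{XY}\}$. Restriction: $\mathcal{K}_{SP}\circ S=\{f_S:\exists f_P,\ (f_S,f_P)\in\mathcal{K}_{SP}\}$; contraction: $\mathcal{K}_{SP}\times S=\{f_S:(f_S,0_P)\in \mathcal{K}_{SP}\}$. Sum (for $S,P,Q$ pairwise disjoint): $\mathcal{K}_{SP}+\mathcal{K}_{PQ}=\{(f_S,f_P,0_Q)+(0_S,g_P,g_Q):(f_S,f_P)\in\mathcal{K}_{SP},(g_P,g_Q)\in\mathcal{K}_{PQ}\}$ on $S\uplus P\uplus Q$. Intersection: $\mathcal{K}_{SP}\cap\mathcal{K}_{PQ}=\{(f_S,h_P,g_Q):(f_S,h_P)\in\mathcal{K}_{SP},(h_P,g_Q)\in\mathcal{K}_{PQ}\}$.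 (For sets on arbitrary, possibly overlapping, finite index sets $A,B$, sum and intersection are defined analogously on $A\cup B$, padding with zero vectors for the sum and with all of $\mathcal F$ for the intersection.) Matched composition: $\mathcal{K}_{SP}\leftrightarrow\mathcal{K}_{PQ}=\{(f_S,g_Q):\exists h_P,\ (f_S,h_P)\in\mathcal{K}_{SP},(h_P,g_Q)\in\mathcal{K}_{PQ}\}$ on $S\uplus Q$; skewed composition: $\mathcal{K}_{SP}\rightleftharpoons\mathcal{K}_{PQ}=\{(f_S,g_Q):\exists h_P,\ (f_S,h_P)\in\mathcal{K}_{SP},(-h_P,g_Q)\in\mathcal{K}_{PQ}\}$. (For general index sets, the common index set plays the role of $P$.) *)

theory Defs
  imports Complex_Main "HOL-Library.Function_Algebras"
begin

text \<open>
  A vector on \<open>X\<close> is represented by the function that extends it by 0 outside \<open>X\<close>. Consequently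
  the zero vectors on all index sets are represented by the same function \<open>0\<close>, and operations on
  sets of vectors take the index sets as explicit arguments.
\<close>

definition vecs :: "'a set \<Rightarrow> ('a \<Rightarrow> rat) set" where
  "vecs X = {f. \<forall>x. x \<notin> X \<longrightarrow> f x = 0}"

definition vec_pair :: "'a set \<Rightarrow> ('a \<Rightarrow> rat) \<Rightarrow> 'a set \<Rightarrow> ('a \<Rightarrow> rat) \<Rightarrow> 'a \<Rightarrow> rat" where
  "vec_pair X f Y g = (\<lambda>x. if x \<in> X then f x else if x \<in> Y then g x else 0)"

global_interpretation ratvec: vector_space "\<lambda>(c::rat) (f::'a \<Rightarrow> rat) x. c * f x"
  by unfold_locales (auto simp: fun_eq_iff algebra_simps)

definition number_lattice :: "'a set \<Rightarrow> ('a \<Rightarrow> rat) set \<Rightarrow> bool" where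
  "number_lattice X L \<longleftrightarrow>
     (\<exists>B. finite B \<and> B \<subseteq> vecs X \<and>
          L = {(\<lambda>x. \<Sum>b\<in>B. of_int (c b) * b x) | c :: ('a \<Rightarrow> rat) \<Rightarrow> int. True})"

definition gen_number_lattice :: "'a set \<Rightarrow> ('a \<Rightarrow> rat) set \<Rightarrow> bool" where
  "gen_number_lattice X K \<longleftrightarrow>
     (\<exists>L V. number_lattice X L \<and> V \<subseteq> vecs X \<and> ratvec.subspace V \<and>
            K = {a + b | a b. a \<in> L \<and> b \<in> V})"

text \<open>In the next three definitions \<open>K\<close> is a set of vectors on the disjoint union of the two given
  index sets.\<close>

definition negate_part :: "'a set \<Rightarrow> 'a set \<Rightarrow> ('a \<Rightarrow> rat) set \<Rightarrow> ('a \<Rightarrow> rat) set" where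
  "negate_part X Y K =
     {vec_pair X (- f) Y g | f g. f \<in> vecs X \<and> g \<in> vecs Y \<and> vec_pair X f Y g \<in> K}"

definition restriction :: "'a set \<Rightarrow> 'a set \<Rightarrow> ('a \<Rightarrow> rat) set \<Rightarrow> ('a \<Rightarrow> rat) set" where
  "restriction S P K = {f \<in> vecs S. \<exists>g \<in> vecs P. vec_pair S f P g \<in> K}"

definition contraction :: "'a set \<Rightarrow> 'a set \<Rightarrow> ('a \<Rightarrow> rat) set \<Rightarrow> ('a \<Rightarrow> rat) set" where
  "contraction S P K = {f \<in> vecs S. vec_pair S f P 0 \<in> K}"

text \<open>Binary operations on a set \<open>K\<close> of vectors on \<open>A\<close> and a set \<open>M\<close> of vectors on \<open>B\<close>, where \<open>A\<close> and
  \<open>B\<close> may overlap. The first two results are sets of vectors on \<open>A \<union> B\<close>, the two compositions are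
  sets of vectors on \<open>(A - B) \<union> (B - A)\<close>.\<close>

definition vsum :: "'a set \<Rightarrow> ('a \<Rightarrow> rat) set \<Rightarrow> 'a set \<Rightarrow> ('a \<Rightarrow> rat) set \<Rightarrow> ('a \<Rightarrow> rat) set" where
  "vsum A K B M =
     {vec_pair A f (B - A) 0 + vec_pair (A - B) 0 B g | f g. f \<in> K \<and> g \<in> M}"

definition vinter :: "'a set \<Rightarrow> ('a \<Rightarrow> rat) set \<Rightarrow> 'a set \<Rightarrow> ('a \<Rightarrow> rat) set \<Rightarrow> ('a \<Rightarrow> rat) set" where
  "vinter A K B M =
     {vec_pair A f (B - A) g | f g. f \<in> K \<and> g \<in> vecs (B - A)} \<inter>
     {vec_pair (A - B) f B g | f g. f \<in> vecs (A - B) \<and> g \<in> M}"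

definition matched :: "'a set \<Rightarrow> ('a \<Rightarrow> rat) set \<Rightarrow> 'a set \<Rightarrow> ('a \<Rightarrow> rat) set \<Rightarrow> ('a \<Rightarrow> rat) set" where
  "matched A K B M =
     {vec_pair (A - B) f (B - A) g | f g. f \<in> vecs (A - B) \<and> g \<in> vecs (B - A) \<and>
        (\<exists>h \<in> vecs (A \<inter> B). vec_pair (A - B) f (A \<inter> B) h \<in> K \<and>
                           vec_pair (A \<inter> B) h (B - A) g \<in> M)}"

definition skewed :: "'a set \<Rightarrow> ('a \<Rightarrow> rat) set \<Rightarrow> 'a set \<Rightarrow> ('a \<Rightarrow> rat) set \<Rightarrow> ('a \<Rightarrow> rat) set" where
  "skewed A K B M =
     {vec_pair (A - B) f (B - A) g | f g. f \<in> vecs (A - B) \<and> g \<in> vecs (B - A) \<and>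
        (\<exists>h \<in> vecs (A \<inter> B). vec_pair (A - B) f (A \<inter> B) h \<in> K \<and>
                           vec_pair (A \<inter> B) (- h) (B - A) g \<in> M)}"

text \<open>Elements are pairs of an index set and a set of vectors on it.\<close>

inductive_set obtained ::
  "('a set \<times> ('a \<Rightarrow> rat) set) set \<Rightarrow> ('a set \<times> ('a \<Rightarrow> rat) set) set"
  for G :: "('a set \<times> ('a \<Rightarrow> rat) set) set" where
  base: "(A, K) \<in> G \<Longrightarrow> (A, K) \<in> obtained G"
| sum: "(A, K) \<in> obtained G \<Longrightarrow> (B, M) \<in> obtained G \<Longrightarrow>
    (A \<union> B, vsum A K B M) \<in> obtained G"
| inter: "(A, K) \<in> obtained G \<Longrightarrow> (B, M) \<in> obtained G \<Longrightarrow>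
    (A \<union> B, vinter A K B M) \<in> obtained G"
| matched: "(A, K) \<in> obtained G \<Longrightarrow> (B, M) \<in> obtained G \<Longrightarrow>
    ((A - B) \<union> (B - A), matched A K B M) \<in> obtained G"
| skewed: "(A, K) \<in> obtained G \<Longrightarrow> (B, M) \<in> obtained G \<Longrightarrow>
    ((A - B) \<union> (B - A), skewed A K B M) \<in> obtained G"

end

theory Submission
  imports Defs
begin

text \<open>Up to the ambient index set, the generalized number lattices are the sets obtained from
  subspaces by adjoining finitely many generators over the integers. This class is closed under linear
  images and sums. It is also closed under intersection with the kernel of a rational functional: by
  Bezout's identity the generators can be rechosen so that the functional vanishes on all of them but
  one. The intersection of two generalized lattices is a projection of the part of their product cut
  out by the functionals \<open>f x - g x\<close>, and both compositions are projections of intersections.\<close>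

section \<open>Adjoining integer generators to a subspace\<close>

abbreviation (input) scale_vec :: "rat \<Rightarrow> ('a \<Rightarrow> rat) \<Rightarrow> 'a \<Rightarrow> rat" where
  "scale_vec c f \<equiv> \<lambda>x. c * f x"

abbreviation linear_map :: "(('a \<Rightarrow> rat) \<Rightarrow> 'b \<Rightarrow> rat) \<Rightarrow> bool" where
  "linear_map \<equiv> Vector_Spaces.linear scale_vec scale_vec"

abbreviation linear_fun :: "(('a \<Rightarrow> rat) \<Rightarrow> rat) \<Rightarrow> bool" where
  "linear_fun \<equiv> Vector_Spaces.linear scale_vec (*)"

lemma linear_map_iff:
  "linear_map T \<longleftrightarrow> (\<forall>f g. T (f + g) = T f + T g) \<and> (\<forall>c f. T (scale_vec c f) = scale_vec c (T f))"
  by (simp add: Vector_Spaces.linear_iff ratvec.vector_space_axioms)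

lemma linear_fun_iff:
  "linear_fun \<phi> \<longleftrightarrow> (\<forall>f g. \<phi> (f + g) = \<phi> f + \<phi> g) \<and> (\<forall>c f. \<phi> (scale_vec c f) = c * \<phi> f)"
proof -
  have "vector_space ((*) :: rat \<Rightarrow> rat \<Rightarrow> rat)"
    by unfold_locales (auto simp: algebra_simps)
  then show ?thesis by (simp add: Vector_Spaces.linear_iff ratvec.vector_space_axioms)
qed

text \<open>The coefficient set is a parameter because both an integer generator
  (\<open>C = \<int>\<close>) and a rational line (\<open>C = UNIV\<close>) occur when a functional
  is split off.\<close>

definition adjoin :: "rat set \<Rightarrow> ('a \<Rightarrow> rat) \<Rightarrow> ('a \<Rightarrow> rat) set \<Rightarrow> ('a \<Rightarrow> rat) set" where
  "adjoin C b K = {k + scale_vec c b | k c. k \<in> K \<and> c \<in> C}"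

text \<open>No index set appears, and generators come one at a time. Closure properties then go by
  induction, and constructions may pass to vectors over another index type.\<close>

inductive gen_lattice :: "('a \<Rightarrow> rat) set \<Rightarrow> bool" where
  subspace: "ratvec.subspace V \<Longrightarrow> gen_lattice V"
| adjoin: "gen_lattice K \<Longrightarrow> gen_lattice (adjoin \<int> b K)"

lemma adjoinI: "k \<in> K \<Longrightarrow> c \<in> C \<Longrightarrow> f = k + scale_vec c b \<Longrightarrow> f \<in> adjoin C b K"
  by (auto simp: adjoin_def)

lemma adjoinE:
  assumes "f \<in> adjoin C b K"
  obtains k c where "k \<in> K" "c \<in> C" "f = k + scale_vec c b"
  using assms by (auto simp: adjoin_def)

lemma adjoin_adjoinE:
  assumes "f \<in> adjoin C a (adjoin D b K)"
  obtains k c d where "k \<in> K" "c \<in> D" "d \<in> C" "f = k + scale_vec c b + scale_vec d a"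
  using assms by (blast elim: adjoinE)

lemma gen_lattice_closed:
  assumes "gen_lattice K"
  shows "0 \<in> K \<and> (\<forall>f\<in>K. \<forall>g\<in>K. f + g \<in> K) \<and> (\<forall>f\<in>K. - f \<in> K)"
  using assms
proof induction
  case (subspace V)
  then show ?case
    by (blast intro: ratvec.subspace_0 ratvec.subspace_add ratvec.subspace_neg)
next
  case (adjoin K b)
  then have K: "0 \<in> K" "\<And>f g. f \<in> K \<Longrightarrow> g \<in> K \<Longrightarrow> f + g \<in> K" "\<And>f. f \<in> K \<Longrightarrow> - f \<in> K" by blast+
  have "0 \<in> adjoin \<int> b K"
    by (rule adjoinI[where c = 0, OF K(1)]) (auto simp: fun_eq_iff)
  moreover have "f + g \<in> adjoin \<int> b K" if fg: "f \<in> adjoin \<int> b K" "g \<in> adjoin \<int> b K" for f g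
  proof -
    from fg(1) obtain k c where "k \<in> K" "c \<in> \<int>" "f = k + scale_vec c b" by (rule adjoinE)
    moreover from fg(2) obtain l d where "l \<in> K" "d \<in> \<int>" "g = l + scale_vec d b" by (rule adjoinE)
    ultimately show ?thesis
      by (intro adjoinI[where k = "k + l" and c = "c + d"] K) (auto simp: fun_eq_iff algebra_simps)
  qed
  moreover have "- f \<in> adjoin \<int> b K" if "f \<in> adjoin \<int> b K" for f
  proof -
    from that obtain k c where "k \<in> K" "c \<in> \<int>" "f = k + scale_vec c b" by (rule adjoinE)
    then show ?thesis
      by (intro adjoinI[where k = "- k" and c = "- c"] K) (auto simp: fun_eq_iff)
  qed
  ultimately show ?case by blast
qed

lemma subspace_vecs: "ratvec.subspace (vecs X)"
  by (auto simp: ratvec.subspace_def vecs_def)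

section \<open>The correspondence with the definition\<close>

text \<open>The lattice from \<open>number_lattice\<close> under a name. Coefficients are indexed by
  the vectors themselves, so each member of \<open>B\<close> has exactly one.\<close>

definition int_span :: "('a \<Rightarrow> rat) set \<Rightarrow> ('a \<Rightarrow> rat) set" where
  "int_span B = {(\<lambda>x. \<Sum>b\<in>B. of_int (c b) * b x) | c :: ('a \<Rightarrow> rat) \<Rightarrow> int. True}"

lemma int_span_empty: "int_span {} = {0}"
  by (auto simp: int_span_def fun_eq_iff)

text \<open>Splitting off the summand of \<open>b\<close> is immediate for a new vector. If
  \<open>b\<close> is already in \<open>B\<close>, its two coefficients have to be merged into
  one.\<close>

lemma int_span_insert:
  assumes "finite B"
  shows "int_span (insert b B) = adjoin \<int> b (int_span B)"
proof (intro equalityI subsetI)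
  fix f assume "f \<in> int_span (insert b B)"
  then obtain c :: "('a \<Rightarrow> rat) \<Rightarrow> int"
    where f: "f = (\<lambda>x. \<Sum>b\<in>insert b B. of_int (c b) * b x)"
    by (auto simp: int_span_def)
  show "f \<in> adjoin \<int> b (int_span B)"
  proof (cases "b \<in> B")
    case True
    then have "f \<in> int_span B" by (auto simp: f int_span_def insert_absorb)
    then show ?thesis by (rule adjoinI[where c = 0]) auto
  next
    case False
    show ?thesis
    proof (rule adjoinI)
      show "(\<lambda>x. \<Sum>b\<in>B. of_int (c b) * b x) \<in> int_span B" by (auto simp: int_span_def)
      show "of_int (c b) \<in> (\<int> :: rat set)" by simp
      show "f = (\<lambda>x. \<Sum>b\<in>B. of_int (c b) * b x) + scale_vec (of_int (c b)) b"
        using False assms by (auto simp: f fun_eq_iff)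
    qed
  qed
next
  fix f assume "f \<in> adjoin \<int> b (int_span B)"
  then obtain k c where "k \<in> int_span B" "c \<in> \<int>" and f: "f = k + scale_vec c b"
    by (rule adjoinE)
  then obtain e :: "('a \<Rightarrow> rat) \<Rightarrow> int" and n :: int
    where k: "k = (\<lambda>x. \<Sum>b\<in>B. of_int (e b) * b x)" and c: "c = of_int n"
    by (auto simp: int_span_def elim!: Ints_cases)
  \<comment> \<open>If \<open>b\<close> already occurs, its coefficient grows by \<open>n\<close>;
    otherwise the arbitrary value of \<open>e\<close> at \<open>b\<close> is replaced by
    \<open>n\<close>.\<close>
  define e' where "e' = (if b \<in> B then e(b := e b + n) else e(b := n))"
  have eq: "(\<Sum>a\<in>B - {b}. of_int (e' a) * a x) = (\<Sum>a\<in>B - {b}. of_int (e a) * a x)" for x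
    by (rule sum.cong) (auto simp: e'_def)
  have "f x = (\<Sum>a\<in>insert b B. of_int (e' a) * a x)" for x
  proof (cases "b \<in> B")
    case True
    then have "(\<Sum>a\<in>insert b B. of_int (e' a) * a x)
        = of_int (e' b) * b x + (\<Sum>a\<in>B - {b}. of_int (e a) * a x)"
      using assms by (simp add: insert_absorb sum.remove eq)
    moreover have "k x = of_int (e b) * b x + (\<Sum>a\<in>B - {b}. of_int (e a) * a x)"
      using True assms by (simp add: k sum.remove)
    ultimately show ?thesis
      using True by (simp add: f c e'_def algebra_simps)
  next
    case False
    then show ?thesis using assms eq[of x] by (simp add: f c k) (simp add: e'_def)
  qed
  then show "f \<in> int_span (insert b B)"
    by (auto simp: int_span_def fun_eq_iff)
qed

text \<open>By associativity and commutativity of addition, a generator of the left summand can be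
  pulled out of the whole sum.\<close>

lemma adjoin_setsum:
  "{a + v | a v. a \<in> adjoin C b K \<and> v \<in> V} = adjoin C b {a + v | a v. a \<in> K \<and> v \<in> V}"
  unfolding adjoin_def
  by (auto simp: add_ac) (metis add.assoc add.commute)+

lemma gen_lattice_int_span_subspace:
  assumes "finite B" "ratvec.subspace V"
  shows "gen_lattice {a + v | a v. a \<in> int_span B \<and> v \<in> V}"
  using assms(1)
proof induction
  case empty
  then show ?case using assms(2) by (auto simp: int_span_empty intro: gen_lattice.subspace)
next
  case (insert b B)
  show ?case
    unfolding int_span_insert[OF insert.hyps(1)] adjoin_setsum
    by (rule gen_lattice.adjoin) (rule insert.IH)
qed

text \<open>The inclusions of \<open>B\<close> and \<open>V\<close> in \<open>K\<close> are recorded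
  so that any \<open>vecs X\<close> containing \<open>K\<close> also contains the generators and the
  subspace, as the definition demands.\<close>

lemma gen_lattice_generators:
  assumes "gen_lattice K"
  shows "\<exists>B V. finite B \<and> B \<subseteq> K \<and> V \<subseteq> K \<and> ratvec.subspace V \<and>
    K = {a + v | a v. a \<in> int_span B \<and> v \<in> V}"
  using assms
proof induction
  case (subspace V)
  then show ?case
    by (intro exI[where x = "{}"] exI[where x = V]) (auto simp: int_span_empty)
next
  case (adjoin K b)
  then obtain B V where BV: "finite B" "B \<subseteq> K" "V \<subseteq> K" "ratvec.subspace V"
    "K = {a + v | a v. a \<in> int_span B \<and> v \<in> V}" by blast
  have sub: "K \<subseteq> adjoin \<int> b K"
    by (auto intro!: adjoinI[where c = 0])
  have b: "b \<in> adjoin \<int> b K"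
    using gen_lattice_closed[OF adjoin.hyps] by (intro adjoinI[where k = 0 and c = 1]) auto
  have "adjoin \<int> b K = {a + v | a v. a \<in> int_span (insert b B) \<and> v \<in> V}"
    by (subst BV(5)) (simp add: int_span_insert BV(1) adjoin_setsum)
  moreover have "finite (insert b B)" "insert b B \<subseteq> adjoin \<int> b K" "V \<subseteq> adjoin \<int> b K"
    using BV(1-3) sub b by blast+
  ultimately show ?case using BV(4) by blast
qed

text \<open>The index set matters only as a bound on supports. The closure proofs can therefore work
  with \<open>gen_lattice\<close> and treat supports separately.\<close>

lemma gen_number_lattice_iff: "gen_number_lattice X K \<longleftrightarrow> gen_lattice K \<and> K \<subseteq> vecs X"
proof
  assume "gen_number_lattice X K"
  then obtain B V where BV: "finite B" "B \<subseteq> vecs X" "V \<subseteq> vecs X" "ratvec.subspace V"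
    "K = {a + v | a v. a \<in> int_span B \<and> v \<in> V}"
    unfolding gen_number_lattice_def number_lattice_def int_span_def by auto
  have "int_span B \<subseteq> vecs X"
    using BV(2) by (auto simp: int_span_def vecs_def subset_iff intro!: sum.neutral)
  then show "gen_lattice K \<and> K \<subseteq> vecs X"
    using BV gen_lattice_int_span_subspace[of B V]
    by (auto intro!: ratvec.subspace_add[OF subspace_vecs])
next
  assume K: "gen_lattice K \<and> K \<subseteq> vecs X"
  from gen_lattice_generators[OF conjunct1[OF K]]
  obtain B V where BV: "finite B" "B \<subseteq> K" "V \<subseteq> K" "ratvec.subspace V"
    "K = {a + v | a v. a \<in> int_span B \<and> v \<in> V}"
    by (elim exE conjE) (rule that; assumption)
  have "B \<subseteq> vecs X" "V \<subseteq> vecs X" using BV(2,3) K by auto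
  then have "number_lattice X (int_span B)"
    unfolding number_lattice_def using BV(1)
    by (intro exI[where x = B]) (simp add: int_span_def)
  with \<open>V \<subseteq> vecs X\<close> BV(4,5) show "gen_number_lattice X K"
    unfolding gen_number_lattice_def
    by (intro exI[where x = "int_span B"] exI[where x = V] conjI)
qed

section \<open>Linear images and sums\<close>

text \<open>Linear maps preserve subspaces and commute with adjoining: the generator
  \<open>b\<close> becomes \<open>T b\<close>.\<close>

lemma gen_lattice_image:
  assumes "gen_lattice K" "linear_map T"
  shows "gen_lattice (T ` K)"
  using assms(1)
proof induction
  case (subspace V)
  have "module_hom scale_vec scale_vec T"
    using assms(2) by (simp add: module_hom_iff_linear)
  then show ?case
    using subspace by (intro gen_lattice.subspace module_hom.subspace_image)
next
  case (adjoin K b)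
  have "T ` adjoin \<int> b K = adjoin \<int> (T b) (T ` K)"
    using assms(2) unfolding adjoin_def linear_map_iff by (auto simp: image_iff) metis+
  then show ?case using adjoin by (simp add: gen_lattice.adjoin)
qed

text \<open>Nested induction: the generators of \<open>K\<close> are pulled out first, then those of
  \<open>M\<close>, until a sum of two subspaces remains.\<close>

lemma gen_lattice_sum:
  assumes "gen_lattice K" "gen_lattice M"
  shows "gen_lattice {f + g | f g. f \<in> K \<and> g \<in> M}"
  using assms(1)
proof induction
  case (subspace V)
  show ?case
    using assms(2)
  proof induction
    case (subspace W)
    then show ?case
      using ratvec.subspace_sums[OF \<open>ratvec.subspace V\<close>, of W] by (intro gen_lattice.subspace)
  next
    case (adjoin M b)
    \<comment> \<open>Generators are pulled out on the left only, so the sum is commuted before and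
      after.\<close>
    have "{f + g | f g. f \<in> V \<and> g \<in> adjoin \<int> b M} = {g + f | g f. g \<in> adjoin \<int> b M \<and> f \<in> V}"
      by (auto; metis add.commute)
    also have "\<dots> = adjoin \<int> b {f + g | f g. f \<in> V \<and> g \<in> M}"
      unfolding adjoin_setsum by (rule arg_cong[of _ _ "adjoin \<int> b"]) (auto; metis add.commute)
    finally have eq: "{f + g | f g. f \<in> V \<and> g \<in> adjoin \<int> b M} = \<dots>" .
    show ?case unfolding eq by (rule gen_lattice.adjoin) (rule adjoin.IH)
  qed
next
  case (adjoin K b)
  show ?case unfolding adjoin_setsum by (rule gen_lattice.adjoin) (rule adjoin.IH)
qed

section \<open>Kernels of rational functionals\<close>

text \<open>Two rationals generate a cyclic subgroup. Over the common denominator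
  \<open>q * r\<close>, its generator \<open>d\<close> has the gcd of the numerators as numerator,
  and Bezout's identity makes the cofactors coprime.\<close>

lemma rat_bezout:
  fixes x y :: rat
  obtains d :: rat and m n u v :: int
  where "x = of_int m * d" "y = of_int n * d" "u * m + v * n = 1"
proof -
  obtain a q where x: "x = of_int a / of_int q" "q > 0"
    using quotient_of_div quotient_of_denom_pos by (metis prod.exhaust)
  obtain c r where y: "y = of_int c / of_int r" "r > 0"
    using quotient_of_div quotient_of_denom_pos by (metis prod.exhaust)
  define g where "g = gcd (a * r) (c * q)"
  show thesis
  proof (cases "g = 0")
    case True
    \<comment> \<open>Both rationals vanish, which forces \<open>d = 0\<close>; the coprime pair 1,
      0 serves as cofactors.\<close>
    then have "x = of_int 1 * 0" "y = of_int 0 * 0" using x y by (auto simp: g_def)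
    then show thesis by (rule that[where u = 1 and v = 0]) simp
  next
    case False
    obtain m n where mn: "a * r = m * g" "c * q = n * g"
      by (metis dvdE gcd_dvd1 gcd_dvd2 g_def mult.commute)
    obtain u v where "u * (a * r) + v * (c * q) = g"
      using bezout_int unfolding g_def by blast
    then have "(u * m + v * n) * g = 1 * g" by (simp add: mn algebra_simps)
    then have uv: "u * m + v * n = 1" using False by (metis mult_cancel_right)
    have "(of_int a * of_int r :: rat) = of_int m * of_int g"
      "(of_int c * of_int q :: rat) = of_int n * of_int g"
      using mn by (metis of_int_mult)+
    moreover have "x = of_int a * of_int r / (of_int q * of_int r)"
      "y = of_int c * of_int q / (of_int q * of_int r)"
      using x y by auto
    ultimately have "x = of_int m * (of_int g / (of_int q * of_int r))"
      "y = of_int n * (of_int g / (of_int q * of_int r))"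
      by auto
    then show thesis using uv by (rule that)
  qed
qed

text \<open>The integer change of generators has rows \<open>(n, -m)\<close> and
  \<open>(u, v)\<close> in the basis \<open>b\<close>, \<open>a\<close>. Its determinant is
  \<open>u * m + v * n = 1\<close>, so it is invertible over the integers.\<close>

lemma adjoin_int_unimodular:
  fixes m n u v :: int
  assumes uv: "u * m + v * n = 1"
  shows "adjoin \<int> a (adjoin \<int> b K) =
    adjoin \<int> (scale_vec (of_int u) b + scale_vec (of_int v) a)
      (adjoin \<int> (scale_vec (of_int n) b - scale_vec (of_int m) a) K)"
    (is "_ = adjoin \<int> ?b (adjoin \<int> ?a K)")
proof (intro equalityI subsetI)
  have uv': "of_int u * of_int m + of_int v * of_int n = (1 :: rat)"
    using uv by (metis of_int_1 of_int_add of_int_mult)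
  \<comment> \<open>The inverse matrix, again integral, recovers the old generators from the new
    ones.\<close>
  have b: "b = scale_vec (of_int m) ?b + scale_vec (of_int v) ?a"
  proof
    fix x
    have "b x = (of_int u * of_int m + of_int v * of_int n) * b x" by (simp add: uv')
    then show "b x = (scale_vec (of_int m) ?b + scale_vec (of_int v) ?a) x"
      by (simp add: algebra_simps)
  qed
  have a: "a = scale_vec (of_int n) ?b - scale_vec (of_int u) ?a"
  proof
    fix x
    have "a x = (of_int u * of_int m + of_int v * of_int n) * a x" by (simp add: uv')
    then show "a x = (scale_vec (of_int n) ?b - scale_vec (of_int u) ?a) x"
      by (simp add: algebra_simps)
  qed
  fix f
  {
    assume "f \<in> adjoin \<int> a (adjoin \<int> b K)"
    then obtain k c d where k: "k \<in> K" "c \<in> \<int>" "d \<in> \<int>"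
      and f: "f = k + scale_vec c b + scale_vec d a" by (rule adjoin_adjoinE)
    have "f = (k + scale_vec (c * of_int v - d * of_int u) ?a)
        + scale_vec (c * of_int m + d * of_int n) ?b"
    proof
      fix x
      have "f x = k x + c * b x + d * a x" by (simp add: f)
      \<comment> \<open>Since \<open>?a\<close> and \<open>?b\<close> themselves contain
        \<open>a\<close> and \<open>b\<close>, the expansions are inserted once by congruence;
        rewriting with them would loop.\<close>
      also have "\<dots> = k x + c * (scale_vec (of_int m) ?b + scale_vec (of_int v) ?a) x
          + d * (scale_vec (of_int n) ?b - scale_vec (of_int u) ?a) x"
        by (rule arg_cong2[where f = "\<lambda>s t. k x + c * s + d * t", OF fun_cong[OF b] fun_cong[OF a]])
      finally show "f x = ((k + scale_vec (c * of_int v - d * of_int u) ?a)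
          + scale_vec (c * of_int m + d * of_int n) ?b) x"
        by (simp add: algebra_simps)
    qed
    then show "f \<in> adjoin \<int> ?b (adjoin \<int> ?a K)"
      using k by (intro adjoinI[OF adjoinI[OF k(1) _ refl]]) auto
  }
  {
    assume "f \<in> adjoin \<int> ?b (adjoin \<int> ?a K)"
    then obtain k c d where k: "k \<in> K" "c \<in> \<int>" "d \<in> \<int>"
      and f: "f = k + scale_vec c ?a + scale_vec d ?b" by (rule adjoin_adjoinE)
    have "f = (k + scale_vec (c * of_int n + d * of_int u) b)
        + scale_vec (d * of_int v - c * of_int m) a"
      by (auto simp: f fun_eq_iff algebra_simps)
    then show "f \<in> adjoin \<int> a (adjoin \<int> b K)"
      using k by (intro adjoinI[OF adjoinI[OF k(1) _ refl]]) auto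
  }
qed

text \<open>Modulo the rational line through \<open>b\<close>, the vectors \<open>a\<close> and
  \<open>a - t b\<close> agree. Later \<open>t\<close> is chosen so that a functional vanishes on
  the shifted generator.\<close>

lemma adjoin_rat_shift:
  "adjoin \<int> a (adjoin UNIV b K) = adjoin UNIV b (adjoin \<int> (a - scale_vec t b) K)"
proof (intro equalityI subsetI)
  fix f
  {
    assume "f \<in> adjoin \<int> a (adjoin UNIV b K)"
    then obtain k c d where k: "k \<in> K" "d \<in> \<int>"
      and f: "f = k + scale_vec c b + scale_vec d a" by (rule adjoin_adjoinE)
    have "f = (k + scale_vec d (a - scale_vec t b)) + scale_vec (c + d * t) b"
      by (auto simp: f fun_eq_iff algebra_simps)
    then show "f \<in> adjoin UNIV b (adjoin \<int> (a - scale_vec t b) K)"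
      using k by (intro adjoinI[OF adjoinI[OF k(1) _ refl]]) auto
  }
  {
    assume "f \<in> adjoin UNIV b (adjoin \<int> (a - scale_vec t b) K)"
    then obtain k c d where k: "k \<in> K" "d \<in> \<int>"
      and f: "f = k + scale_vec d (a - scale_vec t b) + scale_vec c b" by (rule adjoin_adjoinE)
    have "f = (k + scale_vec (c - d * t) b) + scale_vec d a"
      by (auto simp: f fun_eq_iff algebra_simps)
    then show "f \<in> adjoin \<int> a (adjoin UNIV b K)"
      using k by (intro adjoinI[OF adjoinI[OF k(1) _ refl]]) auto
  }
qed

lemma adjoin_subset_kernel:
  assumes "linear_fun \<phi>" "\<And>k. k \<in> K \<Longrightarrow> \<phi> k = 0" "\<phi> b = 0" "f \<in> adjoin C b K"
  shows "\<phi> f = 0"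
  using assms by (auto simp: linear_fun_iff elim!: adjoinE)

text \<open>The induction keeps all generators but one, \<open>b\<close>, in the kernel. A new
  generator \<open>a\<close> is combined with \<open>b\<close> so that again only one exceptional
  direction is left; how depends on whether \<open>b\<close> has integer or rational
  coefficients.\<close>

lemma gen_lattice_split_kernel:
  assumes "gen_lattice K" and \<phi>: "linear_fun \<phi>"
  shows "\<exists>K0 b C. gen_lattice K0 \<and> (\<forall>k\<in>K0. \<phi> k = 0) \<and> (C = \<int> \<or> C = UNIV) \<and> K = adjoin C b K0"
  using assms(1)
proof induction
  case (subspace V)
  show ?case
  proof (cases "\<exists>v\<in>V. \<phi> v \<noteq> 0")
    case True
    then obtain v where v: "v \<in> V" "\<phi> v \<noteq> 0" by blast
    have "ratvec.subspace {f \<in> V. \<phi> f = 0}"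
    proof -
      have "\<phi> (scale_vec 0 0) = 0" using \<phi> unfolding linear_fun_iff by (metis mult_zero_left)
      then have "\<phi> 0 = 0" by (simp add: zero_fun_def)
      then show ?thesis
        using subspace \<phi> by (auto simp: ratvec.subspace_def linear_fun_iff)
    qed
    moreover have "V = adjoin UNIV v {f \<in> V. \<phi> f = 0}"
    proof (intro equalityI subsetI)
      fix f assume f: "f \<in> V"
      \<comment> \<open>Subtracting this multiple of \<open>v\<close> projects \<open>f\<close> into
        the kernel along \<open>v\<close>.\<close>
      define c where "c = \<phi> f / \<phi> v"
      have "f + scale_vec (- c) v \<in> V"
        using f v subspace by (intro ratvec.subspace_add ratvec.subspace_scale)
      moreover have "\<phi> (f + scale_vec (- c) v) = 0"
        using \<phi> v unfolding linear_fun_iff by (simp only:) (simp add: c_def)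
      ultimately show "f \<in> adjoin UNIV v {f \<in> V. \<phi> f = 0}"
        by (intro adjoinI[where k = "f + scale_vec (- c) v" and c = c]) (auto simp: fun_eq_iff)
    next
      fix f assume "f \<in> adjoin UNIV v {f \<in> V. \<phi> f = 0}"
      then show "f \<in> V"
        using v subspace
        by (auto elim!: adjoinE intro!: ratvec.subspace_add ratvec.subspace_scale)
    qed
    ultimately show ?thesis
      by (intro exI[where x = "{f \<in> V. \<phi> f = 0}"] exI[where x = v] exI[where x = UNIV])
        (auto intro: gen_lattice.subspace)
  next
    case False
    \<comment> \<open>With \<open>V\<close> inside the kernel, the zero vector fills the place of
      the exceptional generator.\<close>
    moreover have "V = adjoin UNIV 0 V" by (auto simp: adjoin_def plus_fun_def)
    ultimately show ?thesis
      using gen_lattice.subspace[OF subspace] by blast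
  qed
next
  case (adjoin K a)
  then obtain K0 b C where K0: "gen_lattice K0" "\<forall>k\<in>K0. \<phi> k = 0" "C = \<int> \<or> C = UNIV"
    and K: "K = adjoin C b K0" by blast
  consider "\<phi> b = 0" | "C = UNIV" "\<phi> b \<noteq> 0" | "C = \<int>" using K0 by blast
  then show ?case
  proof cases
    case 1
    \<comment> \<open>All of \<open>K\<close> lies in the kernel, so \<open>K\<close> takes the role
      of \<open>K0\<close> and \<open>a\<close> becomes the exceptional generator.\<close>
    then have "\<forall>k\<in>K. \<phi> k = 0" using adjoin_subset_kernel[OF \<phi>] K0 K by blast
    then show ?thesis using adjoin.hyps by blast
  next
    case 2
    \<comment> \<open>The rational multiple of \<open>b\<close> that cancels the value of
      \<open>\<phi>\<close> at \<open>a\<close>.\<close>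
    let ?a = "a - scale_vec (\<phi> a / \<phi> b) b"
    have "?a = a + scale_vec (- (\<phi> a / \<phi> b)) b" by (auto simp: fun_eq_iff)
    then have "\<phi> ?a = 0"
      using \<phi> 2 unfolding linear_fun_iff by (simp only:) simp
    then have "\<forall>k\<in>adjoin \<int> ?a K0. \<phi> k = 0" using adjoin_subset_kernel[OF \<phi>] K0 by blast
    moreover have "adjoin \<int> a K = adjoin UNIV b (adjoin \<int> ?a K0)"
      unfolding K 2 by (rule adjoin_rat_shift)
    moreover have "UNIV = (\<int> :: rat set) \<or> UNIV = (UNIV :: rat set)" by simp
    ultimately show ?thesis using gen_lattice.adjoin[OF K0(1), of ?a]
      by (intro exI[where x = "adjoin \<int> ?a K0"] exI[where x = "b"] exI[where x = "UNIV"] conjI)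
  next
    case 3
    obtain d m n u v where mn: "\<phi> b = of_int m * d" "\<phi> a = of_int n * d"
      and uv: "u * m + v * n = 1" by (rule rat_bezout)
    \<comment> \<open>On \<open>?a\<close> the values \<open>n * m * d\<close> and
      \<open>m * n * d\<close> cancel, so it joins \<open>K0\<close>; the remaining value
      \<open>d\<close> sits on \<open>?b\<close>.\<close>
    let ?a = "scale_vec (of_int n) b - scale_vec (of_int m) a"
    let ?b = "scale_vec (of_int u) b + scale_vec (of_int v) a"
    have "?a = scale_vec (of_int n) b + scale_vec (- of_int m) a" by (auto simp: fun_eq_iff)
    then have "\<phi> ?a = 0"
      using \<phi> mn unfolding linear_fun_iff by (simp only:) simp
    then have "\<forall>k\<in>adjoin \<int> ?a K0. \<phi> k = 0" using adjoin_subset_kernel[OF \<phi>] K0 by blast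
    moreover have "adjoin \<int> a K = adjoin \<int> ?b (adjoin \<int> ?a K0)"
      unfolding K 3 by (rule adjoin_int_unimodular[OF uv])
    moreover have "\<int> = (\<int> :: rat set) \<or> \<int> = (UNIV :: rat set)" by simp
    ultimately show ?thesis using gen_lattice.adjoin[OF K0(1), of ?a]
      by (intro exI[where x = "adjoin \<int> ?a K0"] exI[where x = "?b"] exI[where x = "\<int>"] conjI)
  qed
qed

text \<open>On \<open>k + c b\<close> with \<open>k\<close> in \<open>K0\<close> the functional
  equals \<open>c * \<phi> b\<close>. The kernel is therefore all of \<open>K\<close> if
  \<open>\<phi> b = 0\<close>, and \<open>K0\<close> otherwise.\<close>

lemma gen_lattice_kernel:
  assumes "gen_lattice K" and \<phi>: "linear_fun \<phi>"
  shows "gen_lattice {f \<in> K. \<phi> f = 0}"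
proof -
  obtain K0 b C where K0: "gen_lattice K0" "\<forall>k\<in>K0. \<phi> k = 0" "C = \<int> \<or> C = UNIV"
    and K: "K = adjoin C b K0" using gen_lattice_split_kernel[OF assms] by blast
  show ?thesis
  proof (cases "\<phi> b = 0")
    case True
    then have "{f \<in> K. \<phi> f = 0} = K" using adjoin_subset_kernel[OF \<phi>] K0 K by blast
    then show ?thesis using assms by simp
  next
    case False
    have "{f \<in> K. \<phi> f = 0} = K0"
    proof (intro equalityI subsetI)
      fix f assume "f \<in> {f \<in> K. \<phi> f = 0}"
      then obtain k c where k: "k \<in> K0" "f = k + scale_vec c b" "\<phi> f = 0"
        by (auto simp: K elim!: adjoinE)
      then have "c * \<phi> b = 0" using \<phi> K0 by (simp add: linear_fun_iff)
      then show "f \<in> K0" using k False by (simp add: plus_fun_def)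
    next
      fix f assume "f \<in> K0"
      then show "f \<in> {f \<in> K. \<phi> f = 0}"
        using K0 by (auto simp: K intro!: adjoinI[where c = 0])
    qed
    then show ?thesis using K0 by simp
  qed
qed

lemma gen_lattice_kernels:
  assumes "finite I" "gen_lattice K" "\<And>i. i \<in> I \<Longrightarrow> linear_fun (\<phi> i)"
  shows "gen_lattice {f \<in> K. \<forall>i\<in>I. \<phi> i f = 0}"
  using assms(1,3)
proof induction
  case empty
  then show ?case using assms(2) by simp
next
  case (insert i I)
  have eq: "{f \<in> K. \<forall>i\<in>insert i I. \<phi> i f = 0} = {f \<in> {f \<in> K. \<forall>i\<in>I. \<phi> i f = 0}. \<phi> i f = 0}"
    by auto
  show ?case unfolding eq using insert by (intro gen_lattice_kernel) auto
qed

section \<open>Intersections through the diagonal\<close>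

text \<open>Finiteness of \<open>X\<close> leaves finitely many functionals expressing that the two
  components of a pair in the product agree. The bound \<open>vecs X\<close> turns agreement on
  \<open>X\<close> into equality.\<close>

lemma gen_lattice_Int:
  fixes K M :: "('a \<Rightarrow> rat) set"
  assumes "finite X" "gen_lattice K" "gen_lattice M" "K \<subseteq> vecs X" "M \<subseteq> vecs X"
  shows "gen_lattice (K \<inter> M)"
proof -
  define inl inr :: "('a \<Rightarrow> rat) \<Rightarrow> 'a + 'a \<Rightarrow> rat"
    where "inl f = case_sum f 0" and "inr f = case_sum 0 f" for f
  \<comment> \<open>The product of \<open>K\<close> and \<open>M\<close>, realised on two disjoint
    copies of the index type as a sum of linear images; \<open>D\<close> is its diagonal
    part.\<close>
  define N where "N = {f + g | f g. f \<in> inl ` K \<and> g \<in> inr ` M}"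
  define D where "D = {f \<in> N. \<forall>x\<in>X. f (Inl x) - f (Inr x) = 0}"
  have "linear_map inl" "linear_map inr"
    by (auto simp: linear_map_iff inl_def inr_def fun_eq_iff split: sum.split)
  then have "gen_lattice N"
    unfolding N_def using assms by (intro gen_lattice_sum gen_lattice_image)
  then have "gen_lattice D"
    unfolding D_def using assms(1)
    by (intro gen_lattice_kernels) (auto simp: linear_fun_iff algebra_simps)
  moreover have "linear_map (\<lambda>f :: 'a + 'a \<Rightarrow> rat. \<lambda>x. f (Inl x))"
    by (auto simp: linear_map_iff fun_eq_iff)
  ultimately have "gen_lattice ((\<lambda>f x. f (Inl x)) ` D)"
    by (rule gen_lattice_image)
  moreover have "(\<lambda>f x. f (Inl x)) ` D = K \<inter> M"
  proof (intro equalityI subsetI)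
    fix h assume "h \<in> (\<lambda>f x. f (Inl x)) ` D"
    then obtain f g where fg: "f \<in> K" "g \<in> M" "h = f" "\<forall>x\<in>X. f x = g x"
      by (auto simp: D_def N_def inl_def inr_def)
    have "f = g"
    proof
      fix x
      show "f x = g x" using fg assms(4,5) by (cases "x \<in> X") (auto simp: vecs_def subset_iff)
    qed
    then show "h \<in> K \<inter> M" using fg by simp
  next
    fix h assume "h \<in> K \<inter> M"
    then have "inl h + inr h \<in> D"
      by (auto simp: D_def N_def inl_def inr_def)
    moreover have "h = (\<lambda>x. (inl h + inr h) (Inl x))"
      by (auto simp: inl_def inr_def)
    ultimately show "h \<in> (\<lambda>f x. f (Inl x)) ` D" by blast
  qed
  ultimately show ?thesis by simp
qed

section \<open>The operations on sets of vectors\<close>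

text \<open>Extension by zero makes pairing on disjoint index sets ordinary addition, which opens
  the operations to the results on sums.\<close>

lemma vec_pair_eq_add:
  "f \<in> vecs X \<Longrightarrow> g \<in> vecs Y \<Longrightarrow> X \<inter> Y = {} \<Longrightarrow> vec_pair X f Y g = f + g"
  by (auto simp: vec_pair_def vecs_def fun_eq_iff)

lemma zero_in_vecs [simp]: "0 \<in> vecs X"
  by (simp add: vecs_def)

lemma vecs_add: "f \<in> vecs X \<Longrightarrow> g \<in> vecs Y \<Longrightarrow> f + g \<in> vecs (X \<union> Y)"
  by (auto simp: vecs_def)

text \<open>Coordinate projection as a linear map on all vectors, so that
  \<open>gen_lattice_image\<close> applies to it.\<close>

definition restrict_vec :: "'a set \<Rightarrow> ('a \<Rightarrow> rat) \<Rightarrow> 'a \<Rightarrow> rat" where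
  "restrict_vec X f = (\<lambda>x. if x \<in> X then f x else 0)"

text \<open>This linear involution serves both for \<open>negate_part\<close> and for the sign in
  the skewed composition.\<close>

definition negate_on :: "'a set \<Rightarrow> ('a \<Rightarrow> rat) \<Rightarrow> 'a \<Rightarrow> rat" where
  "negate_on X f = (\<lambda>x. if x \<in> X then - f x else f x)"

lemma linear_restrict_vec: "linear_map (restrict_vec X)"
  by (auto simp: linear_map_iff restrict_vec_def fun_eq_iff)

lemma linear_negate_on: "linear_map (negate_on X)"
  by (auto simp: linear_map_iff negate_on_def fun_eq_iff)

lemma negate_on_negate_on [simp]: "negate_on X (negate_on X f) = f"
  by (auto simp: negate_on_def)

lemma negate_on_in_vecs [simp]: "negate_on X f \<in> vecs Y \<longleftrightarrow> f \<in> vecs Y"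
  by (auto simp: negate_on_def vecs_def)

lemma in_negate_on_image: "f \<in> negate_on X ` M \<longleftrightarrow> negate_on X f \<in> M"
  by (metis image_iff negate_on_negate_on)

lemma restrict_in_vecs [simp]: "restrict_vec X f \<in> vecs X"
  by (simp add: restrict_vec_def vecs_def)

lemma vsum_eq:
  assumes "K \<subseteq> vecs A" "M \<subseteq> vecs B"
  shows "vsum A K B M = {f + g | f g. f \<in> K \<and> g \<in> M}"
proof -
  have "vec_pair A f (B - A) 0 + vec_pair (A - B) 0 B g = f + g" if "f \<in> K" "g \<in> M" for f g
    using that assms by (subst (1 2) vec_pair_eq_add) auto
  then show ?thesis unfolding vsum_def by (metis (lifting))
qed

text \<open>Padding with all vectors is adding a coordinate subspace, so only closure under sums and
  under intersection on a common index set is required.\<close>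

lemma vinter_eq:
  assumes "K \<subseteq> vecs A" "M \<subseteq> vecs B"
  shows "vinter A K B M =
    {f + g | f g. f \<in> K \<and> g \<in> vecs (B - A)} \<inter> {g + f | g f. g \<in> M \<and> f \<in> vecs (A - B)}"
proof -
  have "vec_pair A f (B - A) g = f + g" if "f \<in> K" "g \<in> vecs (B - A)" for f g
    using that assms by (intro vec_pair_eq_add) auto
  moreover have "vec_pair (A - B) f B g = g + f" if "f \<in> vecs (A - B)" "g \<in> M" for f g
    using that assms by (subst vec_pair_eq_add) (auto simp: add.commute)
  ultimately show ?thesis unfolding vinter_def
    by (intro arg_cong2[of _ _ _ _ "(\<inter>)"]) (auto; metis)+
qed

text \<open>Replaces existentially quantified pairs by restrictions of one vector, the form used for
  both compositions.\<close>

lemma mem_vinter: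
  assumes "K \<subseteq> vecs A" "M \<subseteq> vecs B"
  shows "f \<in> vinter A K B M \<longleftrightarrow> f \<in> vecs (A \<union> B) \<and> restrict_vec A f \<in> K \<and> restrict_vec B f \<in> M"
proof -
  \<comment> \<open>Stated for arbitrary index sets, to be used a second time with the roles of
    \<open>A\<close> and \<open>B\<close> exchanged.\<close>
  have split: "f \<in> {k + g | k g. k \<in> K \<and> g \<in> vecs (B - A)} \<longleftrightarrow> f \<in> vecs (A \<union> B) \<and> restrict_vec A f \<in> K"
    if K: "K \<subseteq> vecs A" for A B and K :: "('a \<Rightarrow> rat) set"
  proof
    assume "f \<in> {k + g | k g. k \<in> K \<and> g \<in> vecs (B - A)}"
    then obtain k g where kg: "k \<in> K" "g \<in> vecs (B - A)" "f = k + g" by blast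
    moreover have "restrict_vec A f = k"
      using kg K by (auto simp: restrict_vec_def vecs_def fun_eq_iff)
    ultimately show "f \<in> vecs (A \<union> B) \<and> restrict_vec A f \<in> K"
      using K vecs_add[of k A g "B - A"] by auto
  next
    assume *: "f \<in> vecs (A \<union> B) \<and> restrict_vec A f \<in> K"
    then have "f = restrict_vec A f + restrict_vec (B - A) f"
      by (auto simp: restrict_vec_def vecs_def fun_eq_iff)
    then show "f \<in> {k + g | k g. k \<in> K \<and> g \<in> vecs (B - A)}"
      using * restrict_in_vecs by blast
  qed
  show ?thesis
    unfolding vinter_eq[OF assms] Int_iff split[OF assms(1)] split[OF assms(2)] by (auto simp: Un_commute)
qed

text \<open>The pieces \<open>f\<close>, \<open>h\<close>, \<open>g\<close> glue to one vector
  \<open>f + h + g\<close> of the intersection; forgetting the common part \<open>h\<close> gives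
  the composition.\<close>

lemma matched_eq:
  assumes "K \<subseteq> vecs A" "M \<subseteq> vecs B"
  shows "matched A K B M = restrict_vec ((A - B) \<union> (B - A)) ` vinter A K B M"
proof (intro equalityI subsetI)
  fix e assume "e \<in> matched A K B M"
  then obtain f g h where fgh: "f \<in> vecs (A - B)" "g \<in> vecs (B - A)" "h \<in> vecs (A \<inter> B)"
    "vec_pair (A - B) f (A \<inter> B) h \<in> K" "vec_pair (A \<inter> B) h (B - A) g \<in> M"
    and e: "e = vec_pair (A - B) f (B - A) g" unfolding matched_def by blast
  have "restrict_vec A (f + h + g) = vec_pair (A - B) f (A \<inter> B) h"
    "restrict_vec B (f + h + g) = vec_pair (A \<inter> B) h (B - A) g"
    "restrict_vec ((A - B) \<union> (B - A)) (f + h + g) = e"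
    "f + h + g \<in> vecs (A \<union> B)"
    using fgh(1-3) by (auto simp: e restrict_vec_def vec_pair_def vecs_def fun_eq_iff)
  then show "e \<in> restrict_vec ((A - B) \<union> (B - A)) ` vinter A K B M"
    using fgh by (auto simp: mem_vinter[OF assms] image_iff intro!: bexI[where x = "f + h + g"])
next
  fix e assume "e \<in> restrict_vec ((A - B) \<union> (B - A)) ` vinter A K B M"
  then obtain f where f: "restrict_vec A f \<in> K" "restrict_vec B f \<in> M"
    and e: "e = restrict_vec ((A - B) \<union> (B - A)) f" by (auto simp: mem_vinter[OF assms])
  have "e = vec_pair (A - B) (restrict_vec (A - B) f) (B - A) (restrict_vec (B - A) f)"
    "vec_pair (A - B) (restrict_vec (A - B) f) (A \<inter> B) (restrict_vec (A \<inter> B) f) = restrict_vec A f"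
    "vec_pair (A \<inter> B) (restrict_vec (A \<inter> B) f) (B - A) (restrict_vec (B - A) f) = restrict_vec B f"
    by (auto simp: e restrict_vec_def vec_pair_def fun_eq_iff)
  then show "e \<in> matched A K B M"
    unfolding matched_def using f restrict_in_vecs by (smt (verit) mem_Collect_eq)
qed

text \<open>The sign of the common part is moved from the vector \<open>h\<close> to the set
  \<open>M\<close>, which reduces every claim on the skewed composition to the matched one.\<close>

lemma skewed_eq: "skewed A K B M = matched A K B (negate_on (A \<inter> B) ` M)"
proof -
  have "vec_pair (A \<inter> B) (- h) (B - A) g = negate_on (A \<inter> B) (vec_pair (A \<inter> B) h (B - A) g)" for h g
    by (auto simp: vec_pair_def negate_on_def fun_eq_iff)
  then show ?thesis unfolding skewed_def matched_def in_negate_on_image by simp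
qed

lemma negate_part_eq:
  assumes "P \<inter> Q = {}" "M \<subseteq> vecs (P \<union> Q)"
  shows "negate_part P Q M = negate_on P ` M"
proof (intro equalityI subsetI)
  fix e assume "e \<in> negate_part P Q M"
  then obtain f g where "vec_pair P f Q g \<in> M" "e = vec_pair P (- f) Q g"
    unfolding negate_part_def by blast
  moreover have "vec_pair P (- f) Q g = negate_on P (vec_pair P f Q g)"
    by (auto simp: vec_pair_def negate_on_def fun_eq_iff)
  ultimately show "e \<in> negate_on P ` M" by simp
next
  fix e assume "e \<in> negate_on P ` M"
  then obtain m where m: "m \<in> M" "e = negate_on P m" by blast
  then have "m \<in> vecs (P \<union> Q)" using assms by blast
  then have "vec_pair P (restrict_vec P m) Q (restrict_vec Q m) = m"
    "e = vec_pair P (- restrict_vec P m) Q (restrict_vec Q m)"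
    using assms(1) m by (auto simp: vec_pair_def negate_on_def restrict_vec_def vecs_def fun_eq_iff)
  then show "e \<in> negate_part P Q M"
    unfolding negate_part_def using m restrict_in_vecs by (smt (verit) mem_Collect_eq)
qed

lemma restriction_eq:
  assumes "N \<subseteq> vecs (S \<union> P)" "S \<inter> P = {}"
  shows "restriction S P N = restrict_vec S ` N"
proof (intro equalityI subsetI)
  fix f assume "f \<in> restriction S P N"
  then obtain g where "f \<in> vecs S" "g \<in> vecs P" "vec_pair S f P g \<in> N"
    unfolding restriction_def by blast
  moreover from this have "f = restrict_vec S (vec_pair S f P g)"
    by (auto simp: restrict_vec_def vec_pair_def vecs_def fun_eq_iff)
  ultimately show "f \<in> restrict_vec S ` N" by blast
next
  fix f assume "f \<in> restrict_vec S ` N"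
  then obtain n where n: "n \<in> N" "f = restrict_vec S n" by blast
  then have "n \<in> vecs (S \<union> P)" using assms by blast
  then have "vec_pair S f P (restrict_vec P n) = n"
    using n assms(2) by (auto simp: restrict_vec_def vec_pair_def vecs_def fun_eq_iff)
  then show "f \<in> restriction S P N"
    unfolding restriction_def using n by (auto intro!: bexI[where x = "restrict_vec P n"])
qed

text \<open>A vector paired with zero is the same function, so contracting only selects the members
  supported on \<open>S\<close>.\<close>

lemma contraction_eq:
  assumes "S \<inter> P = {}"
  shows "contraction S P N = {f \<in> N. f \<in> vecs S}"
  using assms by (auto simp: contraction_def vec_pair_eq_add)

section \<open>Matched composition as restriction and as contraction\<close>

lemma matched_eq_restriction:
  assumes "S \<inter> P = {}" "S \<inter> Q = {}" "P \<inter> Q = {}" "K \<subseteq> vecs (S \<union> P)" "M \<subseteq> vecs (P \<union> Q)"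
  shows "matched (S \<union> P) K (P \<union> Q) M = restriction (S \<union> Q) P (vinter (S \<union> P) K (P \<union> Q) M)"
proof -
  have "(S \<union> P - (P \<union> Q)) \<union> (P \<union> Q - (S \<union> P)) = S \<union> Q" using assms by auto
  moreover have "vinter (S \<union> P) K (P \<union> Q) M \<subseteq> vecs (S \<union> Q \<union> P)"
    using assms by (auto simp: mem_vinter Un_ac)
  ultimately show ?thesis
    using assms by (subst restriction_eq) (auto simp: matched_eq)
qed

text \<open>On \<open>P\<close> the sum of \<open>k\<close> and the sign-changed \<open>m\<close> is
  \<open>k - m\<close>. Having support in \<open>S \<union> Q\<close> thus says exactly that
  \<open>k\<close> and \<open>m\<close> agree on \<open>P\<close>.\<close>

lemma matched_eq_contraction:
  assumes "S \<inter> P = {}" "S \<inter> Q = {}" "P \<inter> Q = {}" "K \<subseteq> vecs (S \<union> P)" "M \<subseteq> vecs (P \<union> Q)"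
  shows "matched (S \<union> P) K (P \<union> Q) M
    = contraction (S \<union> Q) P (vsum (S \<union> P) K (P \<union> Q) (negate_on P ` M))"
proof -
  have M': "negate_on P ` M \<subseteq> vecs (P \<union> Q)" using assms(5) by auto
  have disj: "(S \<union> Q) \<inter> P = {}" using assms by auto
  have D: "(S \<union> P - (P \<union> Q)) \<union> (P \<union> Q - (S \<union> P)) = S \<union> Q" using assms by auto
  show ?thesis
    unfolding contraction_eq[OF disj] vsum_eq[OF assms(4) M'] matched_eq[OF assms(4,5)] D
  proof (intro equalityI subsetI)
    fix e assume "e \<in> restrict_vec (S \<union> Q) ` vinter (S \<union> P) K (P \<union> Q) M"
    then obtain f where f: "restrict_vec (S \<union> P) f \<in> K" "restrict_vec (P \<union> Q) f \<in> M"
      and e: "e = restrict_vec (S \<union> Q) f" by (auto simp: mem_vinter[OF assms(4,5)])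
    have "e \<in> vecs (S \<union> Q)" by (simp add: e)
    moreover have "e = restrict_vec (S \<union> P) f + negate_on P (restrict_vec (P \<union> Q) f)"
      using assms(1-3) by (auto simp: e restrict_vec_def negate_on_def fun_eq_iff)
    ultimately show "e \<in> {f \<in> {f + g | f g. f \<in> K \<and> g \<in> negate_on P ` M}. f \<in> vecs (S \<union> Q)}"
      using f by blast
  next
    fix e assume "e \<in> {f \<in> {f + g | f g. f \<in> K \<and> g \<in> negate_on P ` M}. f \<in> vecs (S \<union> Q)}"
    then obtain k m where km: "k \<in> K" "m \<in> M" "e = k + negate_on P m" "e \<in> vecs (S \<union> Q)"
      by blast
    have k: "k x = 0" if "x \<notin> S" "x \<notin> P" for x using km(1) assms(4) that by (auto simp: vecs_def)
    have m: "m x = 0" if "x \<notin> P" "x \<notin> Q" for x using km(2) assms(5) that by (auto simp: vecs_def)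
    have P: "k x = m x" if "x \<in> P" for x
    proof -
      have "e x = 0" using km(4) that disj by (auto simp: vecs_def)
      then show ?thesis using km(3) that by (simp add: negate_on_def)
    qed
    \<comment> \<open>The common extension of \<open>k\<close> and \<open>m\<close>: the part of
      \<open>m\<close> on \<open>P\<close> is already supplied by \<open>k\<close>.\<close>
    let ?f = "k + restrict_vec Q m"
    have eqs: "restrict_vec (S \<union> P) ?f = k" "restrict_vec (P \<union> Q) ?f = m"
      "restrict_vec (S \<union> Q) ?f = e" "?f \<in> vecs (S \<union> P \<union> (P \<union> Q))"
      using assms(1-3) k m P by (auto simp: restrict_vec_def vecs_def negate_on_def km(3) fun_eq_iff)
    then have "?f \<in> vinter (S \<union> P) K (P \<union> Q) M"
      using km by (simp add: mem_vinter[OF assms(4,5)])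
    then show "e \<in> restrict_vec (S \<union> Q) ` vinter (S \<union> P) K (P \<union> Q) M"
      using eqs(3) by blast
  qed
qed

section \<open>Closure of generalized number lattices under the operations\<close>

lemma gen_number_lattice_vsum:
  assumes "gen_number_lattice A K" "gen_number_lattice B M"
  shows "gen_number_lattice (A \<union> B) (vsum A K B M)"
proof -
  have "vsum A K B M = {f + g | f g. f \<in> K \<and> g \<in> M}"
    using assms by (intro vsum_eq) (auto simp: gen_number_lattice_iff)
  then show ?thesis
    using assms gen_lattice_sum[of K M] by (auto simp: gen_number_lattice_iff intro!: vecs_add)
qed

lemma gen_number_lattice_vinter:
  assumes "finite A" "finite B" "gen_number_lattice A K" "gen_number_lattice B M"
  shows "gen_number_lattice (A \<union> B) (vinter A K B M)"
proof -
  have KM: "K \<subseteq> vecs A" "M \<subseteq> vecs B" "gen_lattice K" "gen_lattice M"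
    using assms by (auto simp: gen_number_lattice_iff)
  have "A \<union> (B - A) = A \<union> B" "B \<union> (A - B) = A \<union> B" by auto
  then have "{f + g | f g. f \<in> K \<and> g \<in> vecs (B - A)} \<subseteq> vecs (A \<union> B)"
    "{g + f | g f. g \<in> M \<and> f \<in> vecs (A - B)} \<subseteq> vecs (A \<union> B)"
    using KM vecs_add[of _ A _ "B - A"] vecs_add[of _ B _ "A - B"] by auto
  then have "gen_lattice (vinter A K B M)"
    unfolding vinter_eq[OF KM(1,2)] using KM assms(1,2)
    by (intro gen_lattice_Int[where X = "A \<union> B"] gen_lattice_sum
        gen_lattice.subspace[OF subspace_vecs]) auto
  then show ?thesis by (auto simp: gen_number_lattice_iff mem_vinter[OF KM(1,2)])
qed

lemma gen_number_lattice_matched: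
  assumes "finite A" "finite B" "gen_number_lattice A K" "gen_number_lattice B M"
  shows "gen_number_lattice ((A - B) \<union> (B - A)) (matched A K B M)"
proof -
  have "K \<subseteq> vecs A" "M \<subseteq> vecs B" using assms by (auto simp: gen_number_lattice_iff)
  then show ?thesis
    using gen_number_lattice_vinter[OF assms]
    by (auto simp: gen_number_lattice_iff matched_eq intro!: gen_lattice_image linear_restrict_vec)
qed

lemma gen_number_lattice_skewed:
  assumes "finite A" "finite B" "gen_number_lattice A K" "gen_number_lattice B M"
  shows "gen_number_lattice ((A - B) \<union> (B - A)) (skewed A K B M)"
  unfolding skewed_eq using assms
  by (intro gen_number_lattice_matched)
    (auto simp: gen_number_lattice_iff intro!: gen_lattice_image linear_negate_on)

text \<open>Finiteness of the index sets is carried through the induction because the closure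
  results for intersections and compositions assume it.\<close>

lemma gen_number_lattice_obtained:
  assumes "\<forall>(A, N) \<in> G. finite A \<and> gen_number_lattice A N" "(A, N) \<in> obtained G"
  shows "finite A \<and> gen_number_lattice A N"
  using assms(2)
proof induction
  case (base A K)
  then show ?case using assms(1) by blast
qed (simp_all add: gen_number_lattice_vsum gen_number_lattice_vinter gen_number_lattice_matched
    gen_number_lattice_skewed)

theorem theorem2:
  fixes S P Q :: "'a set" and K M :: "('a \<Rightarrow> rat) set"
  assumes "finite S" "finite P" "finite Q"
    and "S \<inter> P = {}" "S \<inter> Q = {}" "P \<inter> Q = {}"
    and "gen_number_lattice (S \<union> P) K"
    and "gen_number_lattice (P \<union> Q) M"
  shows
    "(matched (S \<union> P) K (P \<union> Q) M
        = contraction (S \<union> Q) P (vsum (S \<union> P) K (P \<union> Q) (negate_part P Q M)) \<and>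
      matched (S \<union> P) K (P \<union> Q) M
        = restriction (S \<union> Q) P (vinter (S \<union> P) K (P \<union> Q) M) \<and>
      skewed (S \<union> P) K (P \<union> Q) M
        = contraction (S \<union> Q) P (vsum (S \<union> P) K (P \<union> Q) M) \<and>
      skewed (S \<union> P) K (P \<union> Q) M
        = restriction (S \<union> Q) P (vinter (S \<union> P) K (P \<union> Q) (negate_part P Q M))) \<and>
     (gen_number_lattice (S \<union> Q) (matched (S \<union> P) K (P \<union> Q) M) \<and>
      gen_number_lattice (S \<union> Q) (skewed (S \<union> P) K (P \<union> Q) M)) \<and>
     (\<forall>G :: ('a set \<times> ('a \<Rightarrow> rat) set) set.
        finite G \<longrightarrow> (\<forall>(A, N) \<in> G. finite A \<and> gen_number_lattice A N) \<longrightarrow>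
        (\<forall>(A, N) \<in> obtained G. gen_number_lattice A N))"
proof -
  have KM: "K \<subseteq> vecs (S \<union> P)" "M \<subseteq> vecs (P \<union> Q)"
    using assms by (auto simp: gen_number_lattice_iff)
  have neg: "negate_part P Q M = negate_on P ` M"
    using assms KM by (intro negate_part_eq)
  have M': "negate_on P ` M \<subseteq> vecs (P \<union> Q)" using KM by auto
  have "(S \<union> P) \<inter> (P \<union> Q) = P" using assms by auto
  then have sk: "skewed (S \<union> P) K (P \<union> Q) M = matched (S \<union> P) K (P \<union> Q) (negate_on P ` M)"
    by (simp add: skewed_eq)
  \<comment> \<open>The contraction formula for the matched composition, applied to the sign-changed
    \<open>M\<close>, negates \<open>P\<close> a second time; the two signs cancel and leave
    \<open>M\<close> itself.\<close>
  have nn: "negate_on P ` negate_on P ` M = M" by (simp add: image_image)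
  have D: "(S \<union> P - (P \<union> Q)) \<union> (P \<union> Q - (S \<union> P)) = S \<union> Q" using assms by auto
  have fin: "finite (S \<union> P)" "finite (P \<union> Q)" using assms by auto
  note disj = assms(4-6)
  show ?thesis
  proof (intro conjI allI impI)
    show "matched (S \<union> P) K (P \<union> Q) M
        = contraction (S \<union> Q) P (vsum (S \<union> P) K (P \<union> Q) (negate_part P Q M))"
      unfolding neg by (rule matched_eq_contraction[OF disj KM])
    show "matched (S \<union> P) K (P \<union> Q) M
        = restriction (S \<union> Q) P (vinter (S \<union> P) K (P \<union> Q) M)"
      by (rule matched_eq_restriction[OF disj KM])
    show "skewed (S \<union> P) K (P \<union> Q) M
        = contraction (S \<union> Q) P (vsum (S \<union> P) K (P \<union> Q) M)"
      using matched_eq_contraction[OF disj KM(1) M'] unfolding sk nn .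
    show "skewed (S \<union> P) K (P \<union> Q) M
        = restriction (S \<union> Q) P (vinter (S \<union> P) K (P \<union> Q) (negate_part P Q M))"
      unfolding sk neg by (rule matched_eq_restriction[OF disj KM(1) M'])
    show "gen_number_lattice (S \<union> Q) (matched (S \<union> P) K (P \<union> Q) M)"
      using gen_number_lattice_matched[OF fin assms(7,8)] unfolding D .
    show "gen_number_lattice (S \<union> Q) (skewed (S \<union> P) K (P \<union> Q) M)"
      using gen_number_lattice_skewed[OF fin assms(7,8)] unfolding D .
  next
    fix G :: "('a set \<times> ('a \<Rightarrow> rat) set) set"
    assume "\<forall>(A, N) \<in> G. finite A \<and> gen_number_lattice A N"
    then show "\<forall>(A, N) \<in> obtained G. gen_number_lattice A N"
      using gen_number_lattice_obtained by blast
  qed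
qed

end
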